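(* Let $n,L,\kappa$ be positive integers. The following conditions are equivalent: (a) $U_n:\mathcal{R}(L,\kappa)\to\mathcal{R}(L,\kappa)$ is diagonalizable. (b) $\frac{L}{\gcd(L,n)}=L_n$. (c) $Z(n,L)$ has no branches. (d) $n$ is a root in $Z(n,L)$. (e) $H(1)=1$.
   Context: $\mathcal{R}(L,\kappa)$ is the complex vector space of rational functions over $\mathbb{C}$, analytic at the origin, whose Taylor series at the origin has the form $\sum_{k\ge0}k^{\kappa-1}a(k)x^k$ with $a(k+L)=a(k)$ for all $k\ge0$ (with $0^0=1$). $U_n$ is the linear operator $U_n\left(\sum_{k\ge 0}b(k)x^k\right)=\sum_{k\ge 0}b(nk)x^k$. $L_n$ is the largest divisor of $L$ that is coprime with $n$. For any positive integers $n,L$ (not necessarily coprime), the Zolotarev graph $Z(n,L)$ is the directed graph with node set $\mathbb{Z}/L\mathbb{Z}$ and a directed edge from $a$ to $b$ exactly when $na\equiv b\pmod L$. A node $m$ is a leaf if there is no integer $k$ with $nk\equiv m\pmod L$; it is a root if $n^km\equiv m\pmod L$ for some integer $k\ge1$; it is a branch if it is neither a leaf nor a root. The distance $d(a,b)$ between nodes $a,b$ is the smallest integer $k\ge0$ with $n^ka\equiv b\pmod L$ if such a $k$ exists, and $\infty$ otherwise (so $d(a,a)=0$). The height $H(m)$ of a node $m$ is the smallest distance $d(m,r)$ between $m$ and any root $r$ of $Z(n,L)$.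
   Formalization: Condition (e) fails when n and L are coprime (e.g. n = L = 1, where H(1) = 0 but (a)–(d) hold); it is replaced by H(1) ≤ 1 in general, and H(1) = 1 is proved equivalent to the others when n and L are not coprime. *)

theory Defs
  imports
    "HOL-Computational_Algebra.Computational_Algebra"
    "HOL-Number_Theory.Cong"
    "HOL-Library.Extended_Nat"
    "Graph_Theory.Pair_Digraph"
begin

section \<open>The space of rational functions and the operator\<close>

text \<open>
  A rational function that is analytic at the origin is a quotient \<open>p / q\<close> of polynomials with
  \<open>q(0) \<noteq> 0\<close>. We identify it with its Taylor series at the origin, which is the quotient of \<open>p\<close>
  by \<open>q\<close> in the ring of formal power series.
\<close>

definition rational_at_origin :: "complex fps \<Rightarrow> bool" where
  "rational_at_origin f \<longleftrightarrow>
     (\<exists>p q :: complex poly. poly q 0 \<noteq> 0 \<and> f = fps_of_poly p / fps_of_poly q)"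

definition ratfun_space :: "nat \<Rightarrow> nat \<Rightarrow> complex fps set" where
  "ratfun_space L \<kappa> = {f. rational_at_origin f \<and>
     (\<exists>a :: nat \<Rightarrow> complex. (\<forall>k. a (k + L) = a k) \<and>
        f = Abs_fps (\<lambda>k. of_nat k ^ (\<kappa> - 1) * a k))}"

definition U_op :: "nat \<Rightarrow> complex fps \<Rightarrow> complex fps" where
  "U_op n f = Abs_fps (\<lambda>k. fps_nth f (n * k))"

definition fps_scale :: "complex \<Rightarrow> complex fps \<Rightarrow> complex fps" where
  "fps_scale c f = fps_const c * f"

interpretation fps_vs: vector_space fps_scale
  by unfold_locales (simp_all add: fps_scale_def algebra_simps flip: fps_const_add fps_const_mult)

text \<open>
  The operator \<open>T\<close> on the space \<open>V\<close> is diagonalizable if \<open>V\<close> has a basis of eigenvectors of \<open>T\<close>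
  (the members of an independent set are nonzero).
\<close>

definition diagonalizable_on ::
  "('a::field \<Rightarrow> 'b::ab_group_add \<Rightarrow> 'b) \<Rightarrow> 'b set \<Rightarrow> ('b \<Rightarrow> 'b) \<Rightarrow> bool" where
  "diagonalizable_on scale V T \<longleftrightarrow>
     (\<exists>B. \<not> module.dependent scale B \<and> module.span scale B = V \<and>
          (\<forall>v\<in>B. \<exists>c. T v = scale c v))"

text \<open>\<open>U_op n\<close> is a linear operator on \<open>ratfun_space L \<kappa>\<close>:\<close>

lemma rational_at_originI:
  assumes "f * fps_of_poly q = fps_of_poly p" "poly q 0 \<noteq> 0"
  shows "rational_at_origin f"
proof -
  have "fps_of_poly q \<noteq> 0"
    using assms(2) by (auto simp: fps_of_poly_eq_iff simp flip: fps_of_poly_0)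
  hence "f = fps_of_poly p / fps_of_poly q"
    using assms(1) by (metis nonzero_mult_div_cancel_right)
  thus ?thesis
    using assms(2) unfolding rational_at_origin_def by blast
qed

lemma periodic_mult:
  fixes a :: "nat \<Rightarrow> 'a"
  assumes "\<And>k. a (k + L) = a k"
  shows "a (k + L * j) = a k"
proof (induction j)
  case (Suc j)
  thus ?case
    using assms[of "k + L * j"] by (simp add: algebra_simps)
qed simp

lemma rational_at_origin_periodic:
  fixes a :: "nat \<Rightarrow> complex"
  assumes L: "L > 0" and a: "\<And>k. a (k + L) = a k"
  shows "rational_at_origin (Abs_fps (\<lambda>k. of_nat k ^ m * a k))"
proof -
  have "\<exists>p q. poly q 0 \<noteq> 0 \<and>
          Abs_fps (\<lambda>k. of_nat k ^ m * a k) * fps_of_poly q = fps_of_poly p"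
  proof (induction m)
    case 0
    define q :: "complex poly" where "q = 1 - monom 1 L"
    define p :: "complex poly" where "p = (\<Sum>k<L. monom (a k) k)"
    have "Abs_fps a * fps_of_poly q = fps_of_poly p"
    proof (rule fps_ext)
      fix k
      have "fps_nth (Abs_fps a * fps_of_poly q) k = a k - (if k < L then 0 else a (k - L))"
        by (simp add: q_def fps_of_poly_diff fps_of_poly_monom' algebra_simps
            fps_X_power_mult_right_nth)
      also have "\<dots> = (if k < L then a k else 0)"
        using a[of "k - L"] by auto
      also have "\<dots> = fps_nth (fps_of_poly p) k"
        by (simp add: p_def coeff_sum)
      finally show "fps_nth (Abs_fps a * fps_of_poly q) k = fps_nth (fps_of_poly p) k" .
    qed
    moreover have "poly q 0 \<noteq> 0"
      using L by (simp add: q_def poly_monom zero_power)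
    ultimately show ?case
      by auto
  next
    case (Suc m)
    define f where "f = Abs_fps (\<lambda>k. of_nat k ^ m * a k)"
    obtain p q where q: "poly q 0 \<noteq> 0" and pq: "f * fps_of_poly q = fps_of_poly p"
      using Suc unfolding f_def by blast
    have eq: "Abs_fps (\<lambda>k. of_nat k ^ Suc m * a k) = fps_X * fps_deriv f"
      by (rule fps_ext) (auto simp: f_def gr0_conv_Suc)
    have "fps_deriv f * fps_of_poly q + f * fps_of_poly (pderiv q) = fps_of_poly (pderiv p)"
      using arg_cong[OF pq, of fps_deriv] by (simp add: fps_of_poly_pderiv algebra_simps)
    hence d: "fps_deriv f * fps_of_poly q = fps_of_poly (pderiv p) - f * fps_of_poly (pderiv q)"
      by (simp add: algebra_simps)
    have "fps_X * fps_deriv f * fps_of_poly (q * q) =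
            fps_X * (fps_deriv f * fps_of_poly q) * fps_of_poly q"
      by (simp add: fps_of_poly_mult mult_ac)
    also have "\<dots> = fps_X * (fps_of_poly (pderiv p) * fps_of_poly q
                              - (f * fps_of_poly q) * fps_of_poly (pderiv q))"
      unfolding d by (simp add: algebra_simps)
    also have "\<dots> = fps_of_poly ([:0, 1:] * (pderiv p * q - p * pderiv q))"
      unfolding pq by (simp only: fps_of_poly_mult fps_of_poly_diff fps_of_poly_fps_X)
    finally show ?case
      unfolding eq using q by (intro exI[of _ "[:0, 1:] * (pderiv p * q - p * pderiv q)"]
          exI[of _ "q * q"]) simp
  qed
  thus ?thesis
    using rational_at_originI by blast
qed

lemma ratfun_space_iff:
  assumes "L > 0"
  shows "f \<in> ratfun_space L \<kappa> \<longleftrightarrow>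
    (\<exists>a. (\<forall>k. a (k + L) = a k) \<and> f = Abs_fps (\<lambda>k. of_nat k ^ (\<kappa> - 1) * a k))"
  unfolding ratfun_space_def using rational_at_origin_periodic[OF assms] by blast

lemma subspace_ratfun_space:
  assumes "L > 0"
  shows "fps_vs.subspace (ratfun_space L \<kappa>)"
proof (rule fps_vs.subspaceI)
  show "0 \<in> ratfun_space L \<kappa>"
    unfolding ratfun_space_iff[OF assms] by (intro exI[of _ "\<lambda>_. 0"]) (auto intro: fps_ext)
next
  fix f g assume "f \<in> ratfun_space L \<kappa>" "g \<in> ratfun_space L \<kappa>"
  then obtain a b where
    "\<forall>k. a (k + L) = a k" "f = Abs_fps (\<lambda>k. of_nat k ^ (\<kappa> - 1) * a k)"
    "\<forall>k. b (k + L) = b k" "g = Abs_fps (\<lambda>k. of_nat k ^ (\<kappa> - 1) * b k)"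
    unfolding ratfun_space_iff[OF assms] by blast
  thus "f + g \<in> ratfun_space L \<kappa>"
    unfolding ratfun_space_iff[OF assms]
    by (intro exI[of _ "\<lambda>k. a k + b k"]) (auto intro: fps_ext simp: algebra_simps)
next
  fix c f assume "f \<in> ratfun_space L \<kappa>"
  then obtain a where
    "\<forall>k. a (k + L) = a k" "f = Abs_fps (\<lambda>k. of_nat k ^ (\<kappa> - 1) * a k)"
    unfolding ratfun_space_iff[OF assms] by blast
  thus "fps_scale c f \<in> ratfun_space L \<kappa>"
    unfolding ratfun_space_iff[OF assms]
    by (intro exI[of _ "\<lambda>k. c * a k"]) (auto intro: fps_ext simp: fps_scale_def)
qed

lemma U_op_linear:
  "U_op n (f + g) = U_op n f + U_op n g" "U_op n (fps_scale c f) = fps_scale c (U_op n f)"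
  by (auto intro: fps_ext simp: U_op_def fps_scale_def)

lemma U_op_ratfun_space:
  assumes "L > 0" "f \<in> ratfun_space L \<kappa>"
  shows "U_op n f \<in> ratfun_space L \<kappa>"
proof -
  obtain a where a: "\<And>k. a (k + L) = a k"
    and f: "f = Abs_fps (\<lambda>k. of_nat k ^ (\<kappa> - 1) * a k)"
    using assms(2) unfolding ratfun_space_iff[OF assms(1)] by blast
  show ?thesis
    unfolding ratfun_space_iff[OF assms(1)]
  proof (intro exI[of _ "\<lambda>k. of_nat n ^ (\<kappa> - 1) * a (n * k)"] conjI allI)
    fix k show "of_nat n ^ (\<kappa> - 1) * a (n * (k + L)) = of_nat n ^ (\<kappa> - 1) * a (n * k)"
      using periodic_mult[of a L "n * k" n, OF a] by (simp add: algebra_simps)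
  qed (auto intro: fps_ext simp: U_op_def f power_mult_distrib algebra_simps)
qed


section \<open>Zolotarev graphs\<close>

text \<open>
  The nodes, i.e. the elements of \<open>\<int>/L\<int>\<close>, are represented by \<open>0, \<dots>, L - 1\<close>. The notions for
  nodes below are congruence conditions, so they may be applied to any integer representative
  (such as \<open>n\<close> for its residue class).
\<close>

definition zolotarev_graph :: "nat \<Rightarrow> nat \<Rightarrow> int pair_pre_digraph" where
  "zolotarev_graph n L =
     \<lparr> pverts = {0..<int L},
       parcs = {(a, b). a \<in> {0..<int L} \<and> b \<in> {0..<int L} \<and> [int n * a = b] (mod int L)} \<rparr>"

definition is_leaf :: "nat \<Rightarrow> nat \<Rightarrow> int \<Rightarrow> bool" where
  "is_leaf n L m \<longleftrightarrow> \<not> (\<exists>k::int. [int n * k = m] (mod int L))"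

definition is_root :: "nat \<Rightarrow> nat \<Rightarrow> int \<Rightarrow> bool" where
  "is_root n L m \<longleftrightarrow> (\<exists>k::nat. k \<ge> 1 \<and> [int n ^ k * m = m] (mod int L))"

definition is_branch :: "nat \<Rightarrow> nat \<Rightarrow> int \<Rightarrow> bool" where
  "is_branch n L m \<longleftrightarrow> \<not> is_leaf n L m \<and> \<not> is_root n L m"

text \<open>In \<^typ>\<open>enat\<close>, the infimum of a nonempty set is its minimum, and that of \<open>{}\<close> is \<open>\<infinity>\<close>.\<close>

definition node_dist :: "nat \<Rightarrow> nat \<Rightarrow> int \<Rightarrow> int \<Rightarrow> enat" where
  "node_dist n L a b = Inf {enat k | k. [int n ^ k * a = b] (mod int L)}"

definition height :: "nat \<Rightarrow> nat \<Rightarrow> int \<Rightarrow> enat" where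
  "height n L m = Inf {node_dist n L m r | r. r \<in> pverts (zolotarev_graph n L) \<and> is_root n L r}"

definition coprime_part :: "nat \<Rightarrow> nat \<Rightarrow> nat" where
  "coprime_part L n = Max {d. d dvd L \<and> coprime d n}"

text \<open>
  If \<open>n\<close> and \<open>L\<close> are coprime, then every node is a root, and the height of \<open>1\<close> is \<open>0\<close>, not \<open>1\<close>.
\<close>

lemma height_one_coprime:
  assumes "L > 0" "coprime n L"
  shows "height n L 1 = 0"
proof -
  have "\<not> inj (\<lambda>k. n ^ k mod L)"
  proof
    assume "inj (\<lambda>k. n ^ k mod L)"
    moreover have "range (\<lambda>k. n ^ k mod L) \<subseteq> {..<L}"
      using assms(1) by auto
    ultimately show False
      by (metis finite_lessThan finite_subset finite_imageD infinite_UNIV_nat)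
  qed
  then obtain i j where "i < j" and ij: "[n ^ i = n ^ j] (mod L)"
    unfolding cong_def using linorder_injI[of "\<lambda>k. n ^ k mod L"] by auto
  from \<open>i < j\<close> have "n ^ j = n ^ i * n ^ (j - i)"
    by (simp flip: power_add)
  hence "[n ^ i * n ^ (j - i) = n ^ i * 1] (mod L)"
    using ij by (simp add: cong_sym)
  hence "[n ^ (j - i) = 1] (mod L)"
    using assms(2) by (subst (asm) cong_mult_lcancel_nat) auto
  hence "[int n ^ (j - i) = 1] (mod int L)"
    by (metis cong_int_iff of_nat_1 of_nat_power)
  hence "[int n ^ (j - i) * (1 mod int L) = 1 * (1 mod int L)] (mod int L)"
    by (rule cong_scalar_right)
  hence "is_root n L (1 mod int L)"
    unfolding is_root_def using \<open>i < j\<close> by (intro exI[of _ "j - i"]) auto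
  moreover have "1 mod int L \<in> pverts (zolotarev_graph n L)"
    using assms(1) by (simp add: zolotarev_graph_def)
  moreover have "node_dist n L 1 (1 mod int L) = 0"
  proof -
    have "node_dist n L 1 (1 mod int L) \<le> enat 0"
      unfolding node_dist_def by (rule Inf_lower) (auto simp: cong_def intro!: exI[of _ 0])
    thus ?thesis
      by (simp add: zero_enat_def[symmetric])
  qed
  ultimately have "height n L 1 \<le> 0"
    unfolding height_def by (intro Inf_lower) (auto intro!: exI[of _ "1 mod int L"])
  thus ?thesis
    by simp
qed

end

theory Submission
  imports Defs "HOL-Number_Theory.Residues"
begin

text \<open>
  All conditions amount to \<open>n\<close> being a root. Since \<open>n\<close> generates the subgroup \<open>n\<int>/L\<close> of non-leaves,
  and a multiple of a root is a root (\<open>is_root_mult\<close>), there are no branches exactly if this one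
  node is a root. It is also the node that one step from \<open>1\<close> leads to, which gives the
  condition on the height: by \<open>height_le_iff\<close>, the height of a node \<open>m\<close> is the first \<open>k\<close> for which
  \<open>n^k m\<close> is a root.

  Put \<open>l = L / gcd L n\<close>. Cancelling \<open>gcd L n\<close> in \<open>n^k n \<equiv> n (mod L)\<close> leaves \<open>n^k \<equiv> 1 (mod l)\<close>, and
  by Euler's theorem some \<open>k \<ge> 1\<close> satisfies this exactly if \<open>n\<close> is coprime to \<open>l\<close>. Every divisor of
  \<open>L\<close> coprime to \<open>n\<close> divides \<open>l\<close>, so this says that \<open>l\<close> is the largest of them.

  For the operator, let \<open>f\<close> have the coefficients \<open>k^(\<kappa>-1) a(k)\<close>. Then \<open>U_op n\<close> replaces \<open>a(k)\<close> by
  \<open>n^(\<kappa>-1) a(n k)\<close>. If \<open>n\<close> is a root, the powers of \<open>U_op n\<close> are periodic up to a scalar from the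
  first power on, and the space splits into the kernel and eigenspaces obtained by averaging with
  roots of unity (\<open>diagonalizable_on_if_power_eq\<close>).
  Conversely, a diagonalizable operator whose square kills a vector kills that vector itself
  (\<open>diagonalizable_on_kernel_square\<close>). Applied to the indicator function \<open>a\<close> of the residue class of
  \<open>n\<close>, which \<open>U_op n\<close> does not kill, this shows that \<open>n\<close> lies in \<open>n\<^sup>2\<int> + L\<int>\<close>; and this again
  forces \<open>n\<close> to be coprime to \<open>l\<close>.
\<close>

section \<open>Diagonalizable operators\<close>

text \<open>
  In a basis of eigenvectors, two applications multiply each coordinate by \<open>c\<^sup>2\<close> and one by \<open>c\<close>, and
  over a field \<open>c\<^sup>2 r = 0\<close> forces \<open>c r = 0\<close>.
\<close>

lemma diagonalizable_on_kernel_square: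
  fixes scale :: "'a::field \<Rightarrow> 'b::ab_group_add \<Rightarrow> 'b"
  assumes lin: "Vector_Spaces.linear scale scale T"
    and diag: "diagonalizable_on scale V T"
    and f: "f \<in> V" "T (T f) = 0"
  shows "T f = 0"
proof -
  interpret T: Vector_Spaces.linear scale scale T
    by (rule lin)
  obtain B where B: "T.vs1.independent B" "T.vs1.span B = V"
    and eig: "\<forall>v\<in>B. \<exists>c. T v = scale c v"
    using diag unfolding diagonalizable_on_def by blast
  obtain c where c: "\<And>v. v \<in> B \<Longrightarrow> T v = scale (c v) v"
    using eig by metis
  obtain S r where S: "finite S" "S \<subseteq> B" and f_eq: "f = (\<Sum>v\<in>S. scale (r v) v)"
    using f(1) B(2) unfolding T.vs1.span_explicit by blast
  have Tf: "T f = (\<Sum>v\<in>S. scale (r v * c v) v)"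
    unfolding f_eq T.sum using S(2) by (intro sum.cong) (auto simp: T.scale c)
  have "T (T f) = (\<Sum>v\<in>S. scale (r v * c v * c v) v)"
    unfolding Tf T.sum using S(2) by (intro sum.cong) (auto simp: T.scale c)
  hence "r v * c v * c v = 0" if "v \<in> S" for v
    using T.vs1.independentD[OF B(1) S, of "\<lambda>v. r v * c v * c v" v] f(2) that by simp
  hence "r v * c v = 0" if "v \<in> S" for v
    using that by fastforce
  thus ?thesis
    unfolding Tf by (intro sum.neutral) simp
qed

text \<open>
  Summing over the index \<open>j\<close> of the root turns the sum into a geometric one, whose ratio is a
  \<open>k\<close>-th root of unity different from \<open>1\<close> unless \<open>i = 0\<close>.
\<close>

lemma sum_powers_root_of_unity:
  fixes k i :: nat
  assumes "i < k"
  shows "(\<Sum>j<k. cis (2 * pi * real j / real k) ^ i) = (if i = 0 then of_nat k else 0)"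
proof (cases "i = 0")
  case False
  define z where "z = cis (2 * pi * real i / real k)"
  have inj: "inj_on (\<lambda>j. cis (2 * pi * real j / real k)) {..<k}"
    using bij_betw_roots_unity[of k] assms by (auto simp: bij_betw_def)
  have "z \<noteq> 1"
    using inj_onD[OF inj, of i 0] False assms unfolding z_def by fastforce
  have "z ^ k = 1"
    using assms cis_multiple_2pi[of "real i"] unfolding z_def DeMoivre by simp
  have "(\<Sum>j<k. cis (2 * pi * real j / real k) ^ i) = (\<Sum>j<k. z ^ j)"
    unfolding z_def DeMoivre by (intro sum.cong refl arg_cong[of _ _ cis]) simp
  also have "\<dots> = 0"
    using geometric_sum[OF \<open>z \<noteq> 1\<close>, of k] \<open>z ^ k = 1\<close> by simp
  finally show ?thesis
    using False by simp
qed simp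

text \<open>
  A finite Fourier transform along the orbit. For each \<open>k\<close>-th root of unity \<open>z\<close>, the sum of
  \<open>(z / w)^i T^i g\<close> over \<open>i < k\<close> is mapped by \<open>T\<close> to its multiple by \<open>w / z\<close>, and the sum of these
  vectors over all \<open>z\<close> is \<open>k g\<close>.
\<close>

lemma periodic_orbit_in_span_eigenvectors:
  fixes scale :: "complex \<Rightarrow> 'b::ab_group_add \<Rightarrow> 'b"
  assumes lin: "Vector_Spaces.linear scale scale T"
    and V: "module.subspace scale V" "\<And>v. v \<in> V \<Longrightarrow> T v \<in> V"
    and k: "k > 0" and w: "w \<noteq> 0"
    and g: "g \<in> V" "(T ^^ k) g = scale (w ^ k) g"
  shows "g \<in> module.span scale {v \<in> V. \<exists>c. T v = scale c v}"
proof -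
  interpret T: Vector_Spaces.linear scale scale T
    by (rule lin)
  define z where "z = (\<lambda>j. cis (2 * pi * real j / real k))"
  have zk: "z j ^ k = 1" for j
    using k cis_multiple_2pi[of "real j"] unfolding z_def DeMoivre by simp
  have z0: "z j \<noteq> 0" for j
    by (simp add: z_def)
  have orbit: "(T ^^ i) g \<in> V" for i
    by (induction i) (auto simp: g V(2))
  define p where "p = (\<lambda>j. \<Sum>i<k. scale ((z j / w) ^ i) ((T ^^ i) g))"
  have p_V: "p j \<in> V" for j
    unfolding p_def
    by (intro T.vs1.subspace_sum T.vs1.subspace_scale V(1) orbit)
  have p_eig: "T (p j) = scale (w / z j) (p j)" for j
  proof -
    define t where "t = (\<lambda>i. scale ((z j / w) ^ i) ((T ^^ i) g))"
    have "T (p j) = (\<Sum>i<k. scale (w / z j) (t (Suc i)))"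
      unfolding p_def t_def T.sum by (intro sum.cong) (auto simp: T.scale z0 w)
    also have "\<dots> = scale (w / z j) (\<Sum>i<k. t (Suc i))"
      by (simp add: T.vs1.scale_sum_right)
    also have "(\<Sum>i<k. t (Suc i)) = (\<Sum>i<k. t i) + (t k - t 0)"
      using sum_lessThan_telescope[of t k] by (simp add: sum_subtractf algebra_simps)
    \<comment> \<open>The orbit closes up after \<open>k\<close> steps because \<open>(z j / w) ^ k\<close> is the inverse of \<open>w ^ k\<close>.\<close>
    also have "t k = t 0"
      by (simp add: t_def g power_divide zk w)
    finally show ?thesis
      by (simp add: p_def t_def)
  qed
  have "(\<Sum>j<k. p j) = (\<Sum>i<k. scale ((\<Sum>j<k. z j ^ i) / w ^ i) ((T ^^ i) g))"
    unfolding p_def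
    by (subst sum.swap) (simp add: T.vs1.scale_sum_left power_divide sum_divide_distrib)
  also have "\<dots> = (\<Sum>i<k. if i = 0 then scale (of_nat k) g else 0)"
    by (intro sum.cong) (auto simp: z_def sum_powers_root_of_unity)
  also have "\<dots> = scale (of_nat k) g"
    using k by simp
  finally have "g = scale (1 / of_nat k) (\<Sum>j<k. p j)"
    using k by simp
  moreover have "p j \<in> T.vs1.span {v \<in> V. \<exists>c. T v = scale c v}" for j
    using p_V p_eig by (intro T.vs1.span_base) auto
  ultimately show ?thesis
    by (metis (no_types, lifting) T.vs1.span_scale T.vs1.span_sum)
qed

text \<open>
  The polynomial \<open>X (X^k - w^k)\<close> annihilates \<open>T\<close> on \<open>V\<close> and has simple roots. Concretely, the
  vector \<open>g = w^(-k) T^k f\<close> has a periodic orbit up to scaling, while \<open>f - g\<close> lies in the kernel.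
\<close>

lemma diagonalizable_on_if_power_eq:
  fixes scale :: "complex \<Rightarrow> 'b::ab_group_add \<Rightarrow> 'b"
  assumes lin: "Vector_Spaces.linear scale scale T"
    and V: "module.subspace scale V" "\<And>v. v \<in> V \<Longrightarrow> T v \<in> V"
    and k: "k > 0" and w: "w \<noteq> 0"
    and pow: "\<And>f. f \<in> V \<Longrightarrow> (T ^^ Suc k) f = scale (w ^ k) (T f)"
  shows "diagonalizable_on scale V T"
proof -
  interpret T: Vector_Spaces.linear scale scale T
    by (rule lin)
  define E where "E = {v \<in> V. \<exists>c. T v = scale c v}"
  have pow_scale: "(T ^^ i) (scale c f) = scale c ((T ^^ i) f)" for i c f
    by (induction i) (auto simp: T.scale)
  have "f \<in> T.vs1.span E" if f: "f \<in> V" for f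
  proof -
    define g where "g = scale (1 / w ^ k) ((T ^^ k) f)"
    have "(T ^^ i) f \<in> V" for i
      by (induction i) (auto simp: f V(2))
    hence g_V: "g \<in> V"
      unfolding g_def by (intro T.vs1.subspace_scale V(1))
    have step: "(T ^^ k) h = (T ^^ (k - 1)) (T h)" for h
      using k by (cases k) (auto simp: funpow_swap1)
    have "(T ^^ k) ((T ^^ k) f) = (T ^^ (k - 1)) ((T ^^ Suc k) f)"
      unfolding step[of "(T ^^ k) f"] by simp
    also have "\<dots> = scale (w ^ k) ((T ^^ (k - 1)) (T f))"
      unfolding pow[OF f] pow_scale ..
    also have "(T ^^ (k - 1)) (T f) = (T ^^ k) f"
      by (rule step[symmetric])
    finally have "(T ^^ k) g = scale (w ^ k) g"
      unfolding g_def pow_scale by (simp add: T.vs1.scale_left_commute)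
    hence "g \<in> T.vs1.span E"
      unfolding E_def using V(2) by (intro periodic_orbit_in_span_eigenvectors[OF lin V(1) _ k w g_V])
    moreover have "T (f - g) = 0"
      using pow[OF f] w by (simp add: g_def T.diff T.scale)
    hence "f - g \<in> E"
      unfolding E_def using T.vs1.subspace_diff[OF V(1) f g_V] by (auto intro!: exI[of _ 0])
    ultimately have "(f - g) + g \<in> T.vs1.span E"
      using T.vs1.span_add T.vs1.span_base by blast
    thus ?thesis
      by simp
  qed
  moreover obtain B where "B \<subseteq> E" "T.vs1.independent B" "E \<subseteq> T.vs1.span B"
    by (rule T.vs1.maximal_independent_subset)
  moreover have "E \<subseteq> V"
    by (auto simp: E_def)
  ultimately have "T.vs1.span B = V"
    by (metis T.vs1.span_minimal T.vs1.subspace_span V(1) subset_antisym subset_trans subsetI)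
  thus ?thesis
    unfolding diagonalizable_on_def using \<open>B \<subseteq> E\<close> \<open>T.vs1.independent B\<close>
    by (auto simp: E_def)
qed

section \<open>The coprimality criterion\<close>

text \<open>
  A divisor of \<open>L\<close> coprime to \<open>n\<close> is coprime to \<open>gcd L n\<close>, so it divides \<open>L div gcd L n\<close>. This is an
  upper bound for the coprime part that is attained as soon as it is itself coprime to \<open>n\<close>.
\<close>

lemma div_gcd_eq_coprime_part_iff:
  assumes "L > 0"
  shows "L div gcd L n = coprime_part L n \<longleftrightarrow> coprime (L div gcd L n) n"
proof -
  define D where "D = {d. d dvd L \<and> coprime d n}"
  have fin: "finite D"
    using assms by (auto simp: D_def intro: finite_subset[OF _ finite_divisors_nat[of L]])
  have "1 \<in> D"
    by (simp add: D_def)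
  hence max: "Max D \<in> D"
    using fin by (intro Max_in) auto
  have pos: "L div gcd L n > 0"
    using assms by (intro gr0I) (simp add: dvd_div_eq_0_iff)
  have "d \<le> L div gcd L n" if "d \<in> D" for d
  proof -
    have "coprime d (gcd L n)"
      using that coprime_divisors[of d d "gcd L n" n] by (simp add: D_def)
    moreover have "d dvd (L div gcd L n) * gcd L n"
      using that by (simp add: D_def)
    ultimately have "d dvd L div gcd L n"
      using coprime_dvd_mult_left_iff by blast
    thus ?thesis
      using pos by (rule dvd_imp_le)
  qed
  moreover have "L div gcd L n \<in> D" if "coprime (L div gcd L n) n"
    using that dvd_triv_left[of "L div gcd L n" "gcd L n"] by (simp add: D_def)
  ultimately have "coprime (L div gcd L n) n \<longrightarrow> Max D = L div gcd L n"
    using fin by (auto intro!: Max_eqI)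
  moreover have "coprime (L div gcd L n) n" if "L div gcd L n = Max D"
    using max unfolding that by (simp add: D_def)
  ultimately show ?thesis
    unfolding coprime_part_def D_def[symmetric] by metis
qed

text \<open>
  Cancelling \<open>gcd L n\<close> makes \<open>x\<close> an inverse of \<open>n\<close> modulo \<open>L div gcd L n\<close>. With \<open>x\<close> a power of \<open>n\<close>
  this applies to roots, and with \<open>x\<close> arbitrary to the operator.
\<close>

lemma coprime_div_gcd_if_cong:
  fixes x :: int
  assumes "L > 0" and x: "[int n * (int n * x) = int n] (mod int L)"
  shows "coprime (L div gcd L n) n"
proof -
  define g where "g = gcd (int L) (int n)"
  have g0: "g \<noteq> 0"
    using assms(1) by (simp add: g_def)
  obtain l m where lm: "int L = g * l" "int n = g * m" "coprime l m"
    using gcd_coprime_exists[of "int L" "int n"] g0 unfolding g_def by (metis mult.commute)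
  have "int L dvd int n * (int n * x - 1)"
    using x by (simp add: cong_iff_dvd_diff algebra_simps)
  hence "l dvd m * (int n * x - 1)"
    using g0 by (simp add: lm(1) lm(2) mult.assoc)
  hence "l dvd int n * x - 1"
    using lm(3) by (simp add: coprime_dvd_mult_right_iff)
  hence "coprime (int n) l"
    unfolding coprime_iff_invertible_int by (auto simp: cong_iff_dvd_diff)
  moreover have "int (L div gcd L n) = int L div g"
    by (simp add: zdiv_int g_def)
  hence "l = int (L div gcd L n)"
    using nonzero_mult_div_cancel_left[OF g0, of l] by (simp only: lm(1))
  ultimately show ?thesis
    by (simp add: coprime_commute)
qed

lemma is_root_iff_coprime_div_gcd:
  assumes "L > 0"
  shows "is_root n L (int n) \<longleftrightarrow> coprime (L div gcd L n) n"
proof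
  assume "is_root n L (int n)"
  then obtain k where "k \<ge> 1" and k: "[int n ^ k * int n = int n] (mod int L)"
    unfolding is_root_def by blast
  have "int n ^ k * int n = int n * (int n * int n ^ (k - 1))"
    using \<open>k \<ge> 1\<close> by (cases k) auto
  thus "coprime (L div gcd L n) n"
    using k by (intro coprime_div_gcd_if_cong[OF assms, of n "int n ^ (k - 1)"]) metis
next
  define l where "l = L div gcd L n"
  assume "coprime (L div gcd L n) n"
  hence "[n ^ totient l = 1] (mod l)"
    unfolding l_def by (intro euler_theorem) (simp add: coprime_commute)
  hence "[n ^ totient l * gcd L n = 1 * gcd L n] (mod l * gcd L n)"
    by (rule cong_cmult_rightI)
  hence "[n ^ totient l * gcd L n = gcd L n] (mod L)"
    by (simp add: l_def)
  hence "[n ^ totient l * gcd L n * (n div gcd L n) = gcd L n * (n div gcd L n)] (mod L)"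
    by (rule cong_scalar_right)
  hence "[n ^ totient l * n = n] (mod L)"
    by (simp add: mult.assoc)
  hence "[int n ^ totient l * int n = int n] (mod int L)"
    by (metis cong_int_iff of_nat_mult of_nat_power)
  moreover have "l > 0"
    using assms unfolding l_def by (intro gr0I) (simp add: dvd_div_eq_0_iff)
  ultimately show "is_root n L (int n)"
    unfolding is_root_def by (intro exI[of _ "totient l"]) (auto simp: Suc_le_eq)
qed

section \<open>Roots and heights in the Zolotarev graph\<close>

lemma is_root_cong:
  assumes "[a = b] (mod int L)"
  shows "is_root n L a \<longleftrightarrow> is_root n L b"
proof -
  have "[int n ^ k * a = a] (mod int L) \<longleftrightarrow> [int n ^ k * b = b] (mod int L)" for k
    using cong_scalar_left[OF assms, of "int n ^ k"] assms by (metis cong_trans cong_sym)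
  thus ?thesis
    by (simp add: is_root_def)
qed

text \<open>
  A multiple of a root stays a root because multiplication by \<open>n^k\<close> commutes with multiplication
  by \<open>b\<close>. It is used for \<open>a = n\<close>, to treat all non-leaves, and for \<open>a = 1\<close>.
\<close>

lemma is_root_mult:
  assumes "is_root n L a"
  shows "is_root n L (a * b)"
proof -
  obtain k where "k \<ge> 1" "[int n ^ k * a = a] (mod int L)"
    using assms unfolding is_root_def by blast
  hence "[int n ^ k * (a * b) = a * b] (mod int L)"
    using cong_scalar_right by (metis mult.assoc)
  thus ?thesis
    unfolding is_root_def using \<open>k \<ge> 1\<close> by blast
qed

lemma no_branch_iff_is_root:
  assumes "L > 0"
  shows "\<not> (\<exists>m \<in> pverts (zolotarev_graph n L). is_branch n L m) \<longleftrightarrow> is_root n L (int n)"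
proof
  assume *: "\<not> (\<exists>m \<in> pverts (zolotarev_graph n L). is_branch n L m)"
  define m where "m = int n mod int L"
  have m: "[int n = m] (mod int L)"
    by (simp add: m_def cong_def)
  have "m \<in> pverts (zolotarev_graph n L)"
    using assms by (simp add: m_def zolotarev_graph_def)
  moreover have "\<not> is_leaf n L m"
    unfolding is_leaf_def using m by (auto intro!: exI[of _ 1])
  ultimately have "is_root n L m"
    using * by (auto simp: is_branch_def)
  thus "is_root n L (int n)"
    using is_root_cong[OF m] by simp
next
  assume root: "is_root n L (int n)"
  have "is_root n L m" if "\<not> is_leaf n L m" for m
    using that is_root_mult[OF root] is_root_cong unfolding is_leaf_def by blast
  thus "\<not> (\<exists>m \<in> pverts (zolotarev_graph n L). is_branch n L m)"
    by (auto simp: is_branch_def)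
qed

text \<open>
  A finite infimum of extended naturals is attained, because an upper bound \<open>d\<close> is the same as a strict
  upper bound \<open>d + 1\<close>.
\<close>

lemma Inf_enat_le_iff:
  fixes A :: "enat set"
  shows "Inf A \<le> enat d \<longleftrightarrow> (\<exists>x\<in>A. x \<le> enat d)"
proof -
  have "x \<le> enat d \<longleftrightarrow> x < enat (Suc d)" for x
    by (cases x) auto
  thus ?thesis
    by (simp add: Inf_less_iff)
qed

text \<open>
  The roots reachable from \<open>m\<close> are the residues of those \<open>n^k m\<close> that are roots, so the double
  infimum in the definition becomes a single condition on \<open>k\<close>.
\<close>

lemma height_le_iff:
  assumes "L > 0"
  shows "height n L m \<le> enat d \<longleftrightarrow> (\<exists>k\<le>d. is_root n L (int n ^ k * m))"
proof -
  have "height n L m \<le> enat d \<longleftrightarrow>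
          (\<exists>r. r \<in> pverts (zolotarev_graph n L) \<and> is_root n L r \<and>
            (\<exists>k\<le>d. [int n ^ k * m = r] (mod int L)))"
  proof -
    have "node_dist n L m r \<le> enat d \<longleftrightarrow> (\<exists>k\<le>d. [int n ^ k * m = r] (mod int L))" for r
      unfolding node_dist_def Inf_enat_le_iff by auto
    thus ?thesis
      unfolding height_def Inf_enat_le_iff by blast
  qed
  also have "\<dots> \<longleftrightarrow> (\<exists>k\<le>d. is_root n L (int n ^ k * m))"
  proof (intro iffI)
    assume "\<exists>k\<le>d. is_root n L (int n ^ k * m)"
    then obtain k where k: "k \<le> d" "is_root n L (int n ^ k * m)"
      by blast
    define r where "r = (int n ^ k * m) mod int L"
    have r: "[int n ^ k * m = r] (mod int L)"
      by (simp add: r_def cong_def)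
    moreover have "r \<in> pverts (zolotarev_graph n L)"
      using assms by (simp add: r_def zolotarev_graph_def)
    ultimately show "\<exists>r. r \<in> pverts (zolotarev_graph n L) \<and> is_root n L r \<and>
            (\<exists>k\<le>d. [int n ^ k * m = r] (mod int L))"
      using k is_root_cong[OF r] by blast
  qed (use is_root_cong in blast)
  finally show ?thesis .
qed

lemma height_1_le_1_iff:
  assumes "L > 0"
  shows "height n L 1 \<le> 1 \<longleftrightarrow> is_root n L (int n)"
proof -
  have "height n L 1 \<le> 1 \<longleftrightarrow> is_root n L 1 \<or> is_root n L (int n)"
    using height_le_iff[OF assms, of n 1 1] by (auto simp: one_enat_def le_Suc_eq)
  thus ?thesis
    using is_root_mult[of n L 1 "int n"] by auto
qed

lemma height_1_eq_0_imp_coprime: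
  assumes "L > 0" "height n L 1 = 0"
  shows "coprime n L"
proof -
  have "is_root n L 1"
    using height_le_iff[OF assms(1), of n 1 0] assms(2) by (simp add: zero_enat_def)
  then obtain k where "k \<ge> 1" "[int n ^ k = 1] (mod int L)"
    by (auto simp: is_root_def)
  hence "[int n * int n ^ (k - 1) = 1] (mod int L)"
    by (simp flip: power_Suc)
  hence "coprime (int n) (int L)"
    unfolding coprime_iff_invertible_int by blast
  thus ?thesis
    by simp
qed

section \<open>Diagonalizability of the operator and roots\<close>

lemma linear_U_op: "Vector_Spaces.linear fps_scale fps_scale (U_op n)"
  by unfold_locales (simp_all add: U_op_linear)

lemma U_op_funpow_nth: "fps_nth ((U_op n ^^ i) f) j = fps_nth f (n ^ i * j)"
  by (induction i arbitrary: j) (simp_all add: U_op_def mult_ac)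

lemma periodic_cong:
  fixes a :: "nat \<Rightarrow> 'a"
  assumes "\<And>k. a (k + L) = a k" "[i = j] (mod L)"
  shows "a i = a j"
proof -
  have "a i = a (i mod L)" for i
    using periodic_mult[of a L "i mod L" "i div L"] assms(1) by simp
  thus ?thesis
    using assms(2) by (metis cong_def)
qed

text \<open>
  A relation \<open>n^k n \<equiv> n (mod L)\<close> gives \<open>U^(k+1) = w^k U\<close> for \<open>U = U_op n\<close>, with \<open>w = n^(\<kappa>-1)\<close> the
  scalar that each application contributes through the polynomial factor of the coefficients.
\<close>

lemma diagonalizable_U_op_if_is_root:
  assumes "n > 0" "L > 0" and root: "is_root n L (int n)"
  shows "diagonalizable_on fps_scale (ratfun_space L \<kappa>) (U_op n)"
proof -
  obtain k where "k \<ge> 1" and "[int n ^ k * int n = int n] (mod int L)"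
    using root unfolding is_root_def by blast
  hence k: "[n ^ k * n = n] (mod L)"
    by (metis cong_int_iff of_nat_mult of_nat_power)
  define w :: complex where "w = of_nat n ^ (\<kappa> - 1)"
  show ?thesis
  proof (rule diagonalizable_on_if_power_eq[OF linear_U_op subspace_ratfun_space, where k = k and w = w])
    fix f assume "f \<in> ratfun_space L \<kappa>"
    then obtain a where a: "\<And>k. a (k + L) = a k"
      and f: "f = Abs_fps (\<lambda>k. of_nat k ^ (\<kappa> - 1) * a k)"
      unfolding ratfun_space_iff[OF assms(2)] by blast
    have "a (n ^ k * n * j) = a (n * j)" for j
      by (intro periodic_cong[of a, OF a] cong_scalar_right k)
    hence per: "a (n ^ Suc k * j) = a (n * j)" for j
      by (metis power_Suc2)
    show "(U_op n ^^ Suc k) f = fps_scale (w ^ k) (U_op n f)"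
    proof (rule fps_ext)
      fix j
      have "fps_nth ((U_op n ^^ Suc k) f) j = of_nat (n ^ k * (n * j)) ^ (\<kappa> - 1) * a (n ^ Suc k * j)"
        unfolding U_op_funpow_nth by (simp add: f mult_ac)
      also have "\<dots> = w ^ k * (of_nat (n * j) ^ (\<kappa> - 1) * a (n * j))"
        unfolding per by (simp add: w_def power_mult_distrib power_mult[symmetric] mult_ac)
      finally show "fps_nth ((U_op n ^^ Suc k) f) j = fps_nth (fps_scale (w ^ k) (U_op n f)) j"
        by (simp add: f fps_scale_def U_op_def)
    qed
  qed (use assms \<open>k \<ge> 1\<close> in \<open>auto simp: w_def U_op_ratfun_space\<close>)
qed

text \<open>
  The test function is the indicator \<open>a\<close> of the residue class of \<open>n\<close>. Its image under
  \<open>U_op n\<close> is nonzero at the exponent \<open>1\<close>, so by diagonalizability the second image is nonzero too,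
  and an exponent \<open>j\<close> where that happens satisfies \<open>n\<^sup>2 j \<equiv> n (mod L)\<close>.
\<close>

lemma is_root_if_diagonalizable_U_op:
  assumes "n > 0" "L > 0"
    and diag: "diagonalizable_on fps_scale (ratfun_space L \<kappa>) (U_op n)"
  shows "is_root n L (int n)"
proof -
  define a :: "nat \<Rightarrow> complex" where "a = (\<lambda>k. if [k = n] (mod L) then 1 else 0)"
  define f where "f = Abs_fps (\<lambda>k. of_nat k ^ (\<kappa> - 1) * a k)"
  have "f \<in> ratfun_space L \<kappa>"
    unfolding ratfun_space_iff[OF assms(2)] f_def
    by (intro exI[of _ a]) (simp add: a_def cong_def)
  moreover have "fps_nth (U_op n f) 1 \<noteq> 0"
    using assms(1) by (simp add: U_op_def f_def a_def)
  ultimately have "U_op n (U_op n f) \<noteq> 0"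
    using diagonalizable_on_kernel_square[OF linear_U_op diag] by force
  then obtain j where "fps_nth (U_op n (U_op n f)) j \<noteq> 0"
    by (metis fps_nonzero_nth)
  hence "[n * (n * j) = n] (mod L)"
    by (auto simp: U_op_def f_def a_def split: if_splits)
  hence "[int n * (int n * int j) = int n] (mod int L)"
    by (metis cong_int_iff of_nat_mult)
  hence "coprime (L div gcd L n) n"
    by (rule coprime_div_gcd_if_cong[OF assms(2)])
  thus ?thesis
    using is_root_iff_coprime_div_gcd[OF assms(2)] by simp
qed

theorem theorem16:
  fixes n L \<kappa> :: nat
  assumes "n > 0" and "L > 0" and "\<kappa> > 0"
  shows "(diagonalizable_on fps_scale (ratfun_space L \<kappa>) (U_op n) \<longleftrightarrow> L div gcd L n = coprime_part L n) \<and>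
         (L div gcd L n = coprime_part L n \<longleftrightarrow>
            \<not> (\<exists>m \<in> pverts (zolotarev_graph n L). is_branch n L m)) \<and>
         (\<not> (\<exists>m \<in> pverts (zolotarev_graph n L). is_branch n L m) \<longleftrightarrow> is_root n L (int n)) \<and>
         (is_root n L (int n) \<longleftrightarrow> height n L 1 \<le> 1) \<and>
         (\<not> coprime n L \<longrightarrow> (is_root n L (int n) \<longleftrightarrow> height n L 1 = 1))"
proof -
  have diag: "diagonalizable_on fps_scale (ratfun_space L \<kappa>) (U_op n) \<longleftrightarrow> is_root n L (int n)"
    using diagonalizable_U_op_if_is_root[OF assms(1,2)] is_root_if_diagonalizable_U_op[OF assms(1,2)]
    by (rule iffI[rotated])
  have part: "L div gcd L n = coprime_part L n \<longleftrightarrow> is_root n L (int n)"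
    unfolding div_gcd_eq_coprime_part_iff[OF \<open>L > 0\<close>] is_root_iff_coprime_div_gcd[OF \<open>L > 0\<close>] ..
  \<comment> \<open>Height \<open>0\<close> occurs only if \<open>n\<close> is a unit modulo \<open>L\<close>; otherwise \<open>\<le> 1\<close> and \<open>= 1\<close> agree.\<close>
  have "height n L 1 \<le> 1 \<longleftrightarrow> height n L 1 = 0 \<or> height n L 1 = 1"
    by (cases "height n L 1") (auto simp: one_enat_def zero_enat_def)
  hence "height n L 1 \<le> 1 \<longleftrightarrow> height n L 1 = 1" if "\<not> coprime n L"
    using that height_1_eq_0_imp_coprime[OF \<open>L > 0\<close>] by blast
  thus ?thesis
    unfolding diag part no_branch_iff_is_root[OF \<open>L > 0\<close>]
    using height_1_le_1_iff[OF \<open>L > 0\<close>] by blast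
qed

end
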